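(* Let $w\in W(A_m)$ have tower $\tau(w)=(a_1,\dots,a_m)$, and set $a_0=0$. Let $k=\max\{i : 0\le i<m \text{ and } a_i=0\}$. Then $\tau(w^{-1})=(a_1',\dots,a_m')$, where $a_m'=m-k$ and, recursively, $(a_1',\dots,a_{m-1}')=\tau((w')^{-1})$, where $w'=a(m,m-k)\,w$ is a word of length $\ell(w')=\ell(w)-(m-k)$.
   Context: For $m\ge1$, $W(A_m)=\mathsf{Sym}_{m+1}$ is the symmetric group on $\{1,\dots,m+1\}$, with generators $s_i=(i,i+1)$, $1\le i\le m$, permutations multiplied from left to right; $\ell$ is the length with respect to these generators; $W(A_0)$ is trivial and $W(A_{m-1})=\langle s_1,\dots,s_{m-1}\rangle\le W(A_m)$. For $j\ge0$ put $a(j,0)=1$ and $a(j,k)=s_js_{j-1}\cdots s_{j-k+1}$ for $1\le k\le j$, which is the cycle $(j-k+1,j-k+2,\dots,j+1)$. Every $w\in W(A_m)$ can be written uniquely as $w=a(1,a_1)\,a(2,a_2)\cdots a(m,a_m)$ with integers $0\le a_j\le j$, and then $\ell(w)=a_1+\dots+a_m$. The tower of $w$ is the sequence $\tau(w)=(a_1,\dots,a_m)$. The tower of the unique element of $W(A_0)$ is the empty sequence.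
   Formalization: The maximum defining k is taken over 0 ≤ i ≤ m instead of 0 ≤ i < m; the strict bound makes the claim false whenever a_m = 0 (e.g. m = 1, w the identity), and both definitions of k agree when a_m ≠ 0. *)

theory Defs
  imports "HOL-Combinatorics.Permutations"
begin

text \<open>Permutations of \<open>{1..m+1}\<close> are functions on \<^typ>\<open>nat\<close> that fix every point outside
  \<open>{1..m+1}\<close>, so that \<open>W(A_n)\<close> is literally a subgroup of \<open>W(A_m)\<close> for \<open>n \<le> m\<close>.\<close>

definition W :: "nat \<Rightarrow> (nat \<Rightarrow> nat) set" where
  "W m = {w. w permutes {1..m + 1}}"

text \<open>Permutations are multiplied from left to right: first \<open>p\<close>, then \<open>q\<close>.\<close>

abbreviation lr_mult :: "(nat \<Rightarrow> nat) \<Rightarrow> (nat \<Rightarrow> nat) \<Rightarrow> nat \<Rightarrow> nat"  (infixl "\<odot>" 70) where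
  "p \<odot> q \<equiv> q \<circ> p"

primrec lr_prod :: "(nat \<Rightarrow> nat) list \<Rightarrow> nat \<Rightarrow> nat" where
  "lr_prod [] = id"
| "lr_prod (p # ps) = p \<odot> lr_prod ps"

definition gen :: "nat \<Rightarrow> nat \<Rightarrow> nat" where
  "gen i = transpose i (i + 1)"

text \<open>The generators are involutions, so words in the generators alone (without inverses)
  suffice to define the length.\<close>

definition cox_length :: "nat \<Rightarrow> (nat \<Rightarrow> nat) \<Rightarrow> nat" where
  "cox_length m w =
     (LEAST n. \<exists>is. length is = n \<and> set is \<subseteq> {1..m} \<and> w = lr_prod (map gen is))"

text \<open>\<open>a(j,k) = s_j s_{j-1} \<dots> s_{j-k+1}\<close>, with \<open>a(j,0) = 1\<close>; used only for \<open>k \<le> j\<close>.\<close>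

definition desc_word :: "nat \<Rightarrow> nat \<Rightarrow> nat \<Rightarrow> nat" where
  "desc_word j k = lr_prod (map gen (rev [j - k + 1..<j + 1]))"

text \<open>The entry \<open>a_j\<close> of a tower, \<open>1 \<le> j \<le> m\<close>, is stored at list position \<open>j - 1\<close>.
  For \<open>w \<in> W(A_m)\<close> exactly one list satisfies the description.\<close>

definition tower :: "nat \<Rightarrow> (nat \<Rightarrow> nat) \<Rightarrow> nat list" where
  "tower m w =
     (THE as. length as = m \<and> (\<forall>j\<in>{1..m}. as ! (j - 1) \<le> j) \<and>
        w = lr_prod (map (\<lambda>j. desc_word j (as ! (j - 1))) [1..<m + 1]))"

end

theory Submission
  imports Defs
begin

text \<open>Applying \<open>a(m,c)\<close> last moves \<open>m+1\<close> to \<open>m+1-c\<close>, so the last tower entry of \<open>w\<close> is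
  \<open>m+1-w(m+1)\<close>; this gives existence and uniqueness of towers by induction. Counting inversions
  shows that the length is the sum of the tower. If \<open>k\<close> is the last index with \<open>a\<^sub>k = 0\<close>, the
  factors \<open>a(j,a\<^sub>j)\<close> with \<open>j \<le> k\<close> fix \<open>k+1\<close> and the remaining ones push it up one step each, so
  \<open>w(k+1) = m+1\<close>. Hence \<open>w' = a(m,m-k) w\<close> fixes \<open>m+1\<close>, and \<open>w\<^sup>-\<^sup>1 = w'\<^sup>-\<^sup>1 a(m,m-k)\<close> exhibits the tower
  of \<open>w\<^sup>-\<^sup>1\<close>; the length formula follows from \<open>\<ell>(w) = \<ell>(w\<^sup>-\<^sup>1)\<close>.\<close>

section \<open>The cycles a(j,k) as functions on points\<close>

lemma lr_prod_append: "lr_prod (xs @ ys) = lr_prod xs \<odot> lr_prod ys"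
  by (induction xs) (auto simp: comp_assoc)

lemma desc_word_0 [simp]: "desc_word j 0 = id"
  by (simp add: desc_word_def)

lemma desc_word_Suc:
  assumes "Suc c \<le> j"
  shows "desc_word j (Suc c) = desc_word j c \<odot> gen (j - c)"
proof -
  have "[j - Suc c + 1..<j + 1] = (j - c) # [j - c + 1..<j + 1]"
    using assms by (simp add: upt_conv_Cons Suc_diff_Suc del: upt_Suc)
  then show ?thesis
    by (simp add: desc_word_def lr_prod_append del: upt_Suc)
qed

text \<open>Induction on the cycle length: the appended generator acts last, pushing the image
  \<open>j + 1 - c\<close> of \<open>j + 1\<close> one lower and lifting the hitherto fixed point
  \<open>j - c\<close> to \<open>j - c + 1\<close>.\<close>

lemma desc_word_apply:
  assumes "c \<le> j"
  shows "desc_word j c x =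
    (if x = j + 1 then j + 1 - c else if j + 1 - c \<le> x \<and> x \<le> j then x + 1 else x)"
  using assms
proof (induction c)
  case 0
  then show ?case by simp
next
  case (Suc c)
  \<comment> \<open>Writing j as a sum removes all truncated subtractions.\<close>
  then obtain d where "j = Suc (c + d)"
    by (auto dest: less_imp_Suc_add simp: Suc_le_eq)
  with Suc show ?case
    by (auto simp: desc_word_Suc gen_def transpose_def)
qed

lemma lr_prod_gen_permutes:
  assumes "set is \<subseteq> {1..m}"
  shows "lr_prod (map gen is) permutes {1..m + 1}"
  using assms
proof (induction "is")
  case Nil
  show ?case using permutes_id by (simp only: list.map lr_prod.simps)
next
  case (Cons i "is")
  then have "gen i permutes {1..m + 1}"
    unfolding gen_def by (intro permutes_swap_id) auto
  moreover have "lr_prod (map gen is) permutes {1..m + 1}"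
    using Cons by simp
  ultimately show ?case
    unfolding list.map lr_prod.simps by (rule permutes_compose)
qed

lemma desc_word_permutes:
  assumes "c \<le> j" "j \<le> m"
  shows "desc_word j c permutes {1..m + 1}"
  unfolding desc_word_def using assms by (intro lr_prod_gen_permutes) auto

section \<open>Existence and uniqueness of towers\<close>

definition is_tower :: "nat list \<Rightarrow> bool" where
  "is_tower as \<longleftrightarrow> (\<forall>j\<in>{1..length as}. as ! (j - 1) \<le> j)"

text \<open>The product inside \<open>tower\<close>, with m replaced by the length of the list, so
  that inductions can append one entry at the end.\<close>

definition tower_prod :: "nat list \<Rightarrow> nat \<Rightarrow> nat" where
  "tower_prod as = lr_prod (map (\<lambda>j. desc_word j (as ! (j - 1))) [1..<length as + 1])"

lemma is_tower_Nil [simp]: "is_tower []"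
  by (simp add: is_tower_def)

lemma is_tower_snoc: "is_tower (as @ [c]) \<longleftrightarrow> is_tower as \<and> c \<le> length as + 1"
proof -
  have "{1..length (as @ [c])} = insert (length as + 1) {1..length as}" by auto
  then show ?thesis by (auto simp: is_tower_def nth_append)
qed

lemma tower_prod_Nil [simp]: "tower_prod [] = id"
  by (simp add: tower_prod_def)

lemma tower_prod_snoc: "tower_prod (as @ [c]) = tower_prod as \<odot> desc_word (length as + 1) c"
proof -
  have "map (\<lambda>j. desc_word j ((as @ [c]) ! (j - 1))) [1..<length as + 1] =
        map (\<lambda>j. desc_word j (as ! (j - 1))) [1..<length as + 1]"
    by (rule map_cong) (auto simp: nth_append)
  moreover have "[1..<length (as @ [c]) + 1] = [1..<length as + 1] @ [length as + 1]" by simp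
  ultimately show ?thesis
    by (simp add: tower_prod_def lr_prod_append del: upt_Suc map_eq_conv)
qed

lemma tower_prod_permutes: "is_tower as \<Longrightarrow> tower_prod as permutes {1..length as + 1}"
proof (induction as rule: rev_induct)
  case Nil
  show ?case using permutes_id by (simp only: list.map lr_prod.simps tower_prod_Nil)
next
  case (snoc c as)
  then have "tower_prod as permutes {1..length (as @ [c]) + 1}"
    by (auto simp: is_tower_snoc intro: permutes_subset)
  moreover have "desc_word (length as + 1) c permutes {1..length (as @ [c]) + 1}"
    using snoc.prems by (intro desc_word_permutes) (auto simp: is_tower_snoc)
  ultimately show ?case
    unfolding tower_prod_snoc by (rule permutes_compose)
qed

lemma tower_prod_inject:
  assumes "length as = length bs" "is_tower as" "is_tower bs" "tower_prod as = tower_prod bs"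
  shows "as = bs"
  using assms
proof (induction as arbitrary: bs rule: rev_induct)
  case Nil
  then show ?case by simp
next
  case (snoc c as)
  obtain bs' d where bs: "bs = bs' @ [d]"
    using snoc.prems(1) by (cases bs rule: rev_cases) auto
  have len: "length bs' = length as" using snoc.prems(1) bs by simp
  let ?m = "length as + 1"
  have tow: "is_tower as" "is_tower bs'" "c \<le> ?m" "d \<le> ?m"
    using snoc.prems len by (auto simp: bs is_tower_snoc)
  have eq: "tower_prod as \<odot> desc_word ?m c = tower_prod bs' \<odot> desc_word ?m d"
    using snoc.prems(4) unfolding bs tower_prod_snoc len .
  have fixed: "tower_prod as (?m + 1) = ?m + 1" "tower_prod bs' (?m + 1) = ?m + 1"
    using tower_prod_permutes[OF tow(1)] tower_prod_permutes[OF tow(2)] len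
    by (auto simp: permutes_def)
  \<comment> \<open>Both shorter products fix the top point \<open>?m + 1\<close>, so its image
    depends on the last factor alone.\<close>
  have "?m + 1 - c = ?m + 1 - d"
    using fun_cong[OF eq, of "?m + 1"] fixed tow by (simp add: desc_word_apply)
  then have cd: "c = d" using tow by linarith
  have "inj (desc_word ?m c)"
    using desc_word_permutes[of c ?m ?m] tow by (auto intro: permutes_inj)
  then have "tower_prod as x = tower_prod bs' x" for x
    using fun_cong[OF eq, of x] len by (simp add: cd inj_eq)
  then have "tower_prod as = tower_prod bs'" ..
  then show ?case
    using snoc.IH len tow cd bs by simp
qed

lemma permutes_fixing_last:
  fixes p :: "nat \<Rightarrow> nat"
  assumes "p permutes {1..m + 1}" "p (m + 1) = m + 1"
  shows "p permutes {1..m}"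
proof (rule permutes_superset[OF assms(1)])
  fix x assume "x \<in> {1..m + 1} - {1..m}"
  then have "x = m + 1" by auto
  with assms(2) show "p x = x" by simp
qed

lemma tower_prod_surj:
  assumes "w \<in> W m"
  shows "\<exists>as. length as = m \<and> is_tower as \<and> tower_prod as = w"
  using assms
proof (induction m arbitrary: w)
  case 0
  then show ?case by (auto simp: W_def)
next
  case (Suc m)
  then have w: "w permutes {1..Suc m + 1}" by (simp add: W_def)
  then have "w (m + 2) \<in> {1..m + 2}"
    using permutes_in_image[OF w, of "m + 2"] by simp
  \<comment> \<open>The top point of \<open>W (Suc m)\<close> is \<open>m + 2\<close>; the bound on
    c holds because its image is at least 1.\<close>
  then obtain c where c: "c \<le> m + 1" "w (m + 2) = m + 2 - c"
    by (intro that[of "m + 2 - w (m + 2)"]) auto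
  define D where "D = desc_word (m + 1) c"
  have D: "D permutes {1..Suc m + 1}"
    unfolding D_def using c by (intro desc_word_permutes) auto
  have "D (m + 2) = w (m + 2)"
    unfolding D_def using c by (simp add: desc_word_apply)
  \<comment> \<open>Composing with \<open>inv D\<close> on the left strips the last factor of the
    left-to-right product; what remains fixes the top point.\<close>
  then have "(inv D \<circ> w) (Suc m + 1) = Suc m + 1"
    using permutes_inverses(2)[OF D, of "m + 2"] by simp
  with permutes_compose[OF w permutes_inv[OF D]] have "inv D \<circ> w permutes {1..Suc m}"
    by (rule permutes_fixing_last)
  then have "inv D \<circ> w \<in> W m"
    by (simp only: W_def mem_Collect_eq Suc_eq_plus1)
  from Suc.IH[OF this] obtain as
    where as: "length as = m" "is_tower as" "tower_prod as = inv D \<circ> w" by blast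
  have "tower_prod (as @ [c]) = D \<circ> (inv D \<circ> w)"
    by (simp add: tower_prod_snoc as D_def)
  also have "\<dots> = w"
    by (simp add: comp_assoc[symmetric] permutes_inv_o(1)[OF D])
  finally show ?case
    using as c by (intro exI[of _ "as @ [c]"]) (simp add: is_tower_snoc)
qed

text \<open>Discharges the definite description: from here on a tower is computed by exhibiting a
  list with the right product.\<close>

lemma tower_tower_prod:
  assumes "is_tower as" "length as = m"
  shows "tower m (tower_prod as) = as"
proof -
  have "tower m (tower_prod as) =
      (THE bs. length bs = m \<and> is_tower bs \<and> tower_prod as = tower_prod bs)"
    unfolding tower_def by (rule arg_cong[where f = The])
      (auto simp: is_tower_def tower_prod_def fun_eq_iff)
  also have "\<dots> = as"
    using assms tower_prod_inject by (intro the_equality) auto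
  finally show ?thesis .
qed

lemma tower_props:
  assumes "w \<in> W m"
  shows "length (tower m w) = m" "is_tower (tower m w)" "tower_prod (tower m w) = w"
proof -
  obtain as where "length as = m" "is_tower as" "tower_prod as = w"
    using tower_prod_surj[OF assms] by blast
  moreover from this have "tower m w = as"
    using tower_tower_prod by blast
  ultimately show "length (tower m w) = m" "is_tower (tower m w)" "tower_prod (tower m w) = w"
    by simp_all
qed

section \<open>Inversions and length\<close>

definition inversions :: "(nat \<Rightarrow> nat) \<Rightarrow> (nat \<times> nat) set" where
  "inversions w = {(x, y). x < y \<and> w y < w x}"

text \<open>Points outside the support create no inversions, so counting over all naturals is finite
  and independent of the ambient group.\<close>

lemma inversions_subset:
  assumes "w permutes {1..n}"
  shows "inversions w \<subseteq> {1..n} \<times> {1..n}"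
proof
  fix z assume "z \<in> inversions w"
  then obtain x y where z: "z = (x, y)" "x < y" "w y < w x" by (auto simp: inversions_def)
  have out: "w v = v" if "v \<notin> {1..n}" for v using assms that by (auto simp: permutes_def)
  have "in": "w v \<in> {1..n} \<longleftrightarrow> v \<in> {1..n}" for v using permutes_in_image[OF assms] .
  show "z \<in> {1..n} \<times> {1..n}"
    using z out[of x] out[of y] "in"[of x] "in"[of y] by auto
qed

lemma finite_inversions: "w permutes {1..n} \<Longrightarrow> finite (inversions w)"
  by (rule finite_subset[OF inversions_subset]) auto

text \<open>Swapping the adjacent values i and i + 1 changes only the comparison between the two
  positions carrying them, so at most one inversion is new.\<close>

lemma card_inversions_gen:
  assumes "w permutes {1..n}"
  shows "card (inversions (w \<odot> gen i)) \<le> card (inversions w) + 1"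
proof -
  have inj: "w x = w y \<longleftrightarrow> x = y" for x y
    using permutes_inj[OF assms] by (simp add: inj_eq)
  have "inversions (w \<odot> gen i) \<subseteq> insert (inv w i, inv w (i + 1)) (inversions w)"
  proof (clarify)
    fix x y
    assume xy: "(x, y) \<in> inversions (w \<odot> gen i)" and "(x, y) \<notin> inversions w"
    then have "w x = i \<and> w y = i + 1"
      using inj[of x y] by (auto simp: inversions_def gen_def transpose_def split: if_splits)
    then show "x = inv w i \<and> y = inv w (i + 1)"
      using permutes_inverses(2)[OF assms] by metis
  qed
  then have "card (inversions (w \<odot> gen i)) \<le> card (insert (inv w i, inv w (i + 1)) (inversions w))"
    using finite_inversions[OF assms] by (intro card_mono) auto
  also have "\<dots> \<le> card (inversions w) + 1"
    by (simp add: card_insert_if finite_inversions[OF assms])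
  finally show ?thesis .
qed

lemma inversions_id [simp]: "inversions id = {}"
  by (auto simp: inversions_def)

lemma card_inversions_word:
  assumes "set is \<subseteq> {1..m}"
  shows "card (inversions (lr_prod (map gen is))) \<le> length is"
  using assms
proof (induction "is" rule: rev_induct)
  case Nil
  show ?case by (simp only: list.map lr_prod.simps inversions_id card.empty le0)
next
  case (snoc i "is")
  then have "lr_prod (map gen is) permutes {1..m + 1}"
    by (intro lr_prod_gen_permutes) auto
  from card_inversions_gen[OF this, of i]
  have "card (inversions (lr_prod (map gen (is @ [i])))) \<le> card (inversions (lr_prod (map gen is))) + 1"
    by (simp only: map_append list.map lr_prod_append lr_prod.simps id_comp)
  with snoc show ?case by simp
qed

text \<open>The cycle is increasing on values up to m, so the inversions of u survive; the value at
  position m + 1 drops below exactly c others.\<close>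

lemma card_inversions_desc_word:
  assumes u: "u permutes {1..m}" and c: "c \<le> m"
  shows "card (inversions (u \<odot> desc_word m c)) = card (inversions u) + c"
proof -
  \<comment> \<open>The new inversions: the positions of the c overtaken values, each paired with
    position m + 1.\<close>
  let ?N = "(\<lambda>v. (inv u v, m + 1)) ` {m + 1 - c..m}"
  have out: "u v = v" if "v \<notin> {1..m}" for v using u that by (auto simp: permutes_def)
  have in_im: "u v \<in> {1..m} \<longleftrightarrow> v \<in> {1..m}" for v using permutes_in_image[OF u] .
  have inv_u: "inv u (u v) = v" "u (inv u v) = v" for v
    using permutes_inverses[OF u] by auto
  have le_m: "u v \<le> m" if "v \<le> m" for v
    using that out[of v] in_im[of v] by (cases "v = 0") auto
  let ?D = "desc_word m c"
  have D_le: "?D v = (if m + 1 - c \<le> v then v + 1 else v)" if "v \<le> m" for v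
    using that c by (simp add: desc_word_apply)
  have D_last: "?D (m + 1) = m + 1 - c" using c by (simp add: desc_word_apply)
  have D_gt: "?D v = v" if "v > m + 1" for v using that c by (simp add: desc_word_apply)
  have "inversions (u \<odot> ?D) = inversions u \<union> ?N"
  proof (intro set_eqI iffI; clarify)
    fix x y
    assume xy: "(x, y) \<in> inversions (u \<odot> desc_word m c)" "(x, y) \<notin> ?N"
    have *: "(x, y) \<in> ?N" if "u x \<in> {m + 1 - c..m}" "y = m + 1"
      using that inv_u(1)[of x] by (intro image_eqI[of _ _ "u x"]) auto
    have less: "x < y" "?D (u y) < ?D (u x)" using xy(1) by (auto simp: inversions_def)
    show "(x, y) \<in> inversions u"
    proof (cases y "m + 1" rule: linorder_cases)
      case less
      then have "u x \<le> m" "u y \<le> m" using \<open>x < y\<close> by (auto intro: le_m)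
      then have "u y < u x" using \<open>?D (u y) < ?D (u x)\<close> by (simp add: D_le split: if_splits)
      then show ?thesis using \<open>x < y\<close> by (simp add: inversions_def)
    next
      case equal
      then have "u x \<le> m" using \<open>x < y\<close> by (auto intro: le_m)
      moreover have "u x < m + 1 - c" using * xy(2) \<open>u x \<le> m\<close> equal by fastforce
      moreover have "?D (u y) = m + 1 - c" unfolding equal using out[of "m + 1"] D_last by simp
      ultimately show ?thesis using less(2) D_le[of "u x"] by simp
    next
      case greater
      then have "?D (u y) = y" using out[of y] D_gt by simp
      \<comment> \<open>A position y beyond m + 1 is fixed, and this bound keeps every earlier image
        below y, so no inversion ends there.\<close>
      moreover have "?D (u x) \<le> max x (m + 1)"
      proof (cases "x \<le> m")
        case True
        then show ?thesis using D_le le_m[of x] by simp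
      next
        case False
        then show ?thesis using out[of x] D_last D_gt[of x] by (cases "x = m + 1") auto
      qed
      ultimately show ?thesis using less greater by simp
    qed
  next
    fix x y
    assume "(x, y) \<in> inversions u \<union> ?N"
    then show "(x, y) \<in> inversions (u \<odot> desc_word m c)"
    proof
      assume xy: "(x, y) \<in> inversions u"
      then have "x \<in> {1..m}" "y \<in> {1..m}" using inversions_subset[OF u] by auto
      then have "u x \<in> {1..m}" "u y \<in> {1..m}" using in_im by blast+
      with xy c show ?thesis
        by (auto simp: inversions_def desc_word_apply)
    next
      assume "(x, y) \<in> ?N"
      then obtain v where v: "v \<in> {m + 1 - c..m}" "x = inv u v" "y = m + 1" by auto
      then have "u x = v" by (simp add: inv_u)
      moreover have "x \<in> {1..m}" using v c \<open>u x = v\<close> in_im[of x] by auto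
      ultimately show ?thesis
        using v out[of y] c by (auto simp: inversions_def desc_word_apply)
    qed
  qed
  moreover have "inversions u \<inter> ?N = {}"
    using inversions_subset[OF u] by auto
  moreover have "card ?N = c"
    using c by (subst card_image) (auto intro!: inj_onI dest: arg_cong[where f = u] simp: inv_u)
  ultimately show ?thesis
    using finite_inversions[OF u] by (simp add: card_Un_disjoint)
qed

lemma card_inversions_tower_prod:
  "is_tower as \<Longrightarrow> card (inversions (tower_prod as)) = sum_list as"
proof (induction as rule: rev_induct)
  case Nil
  show ?case by (simp only: tower_prod_Nil inversions_id card.empty sum_list.Nil)
next
  case (snoc c as)
  then have "is_tower as" "c \<le> length as + 1" by (auto simp: is_tower_snoc)
  then have "card (inversions (tower_prod (as @ [c]))) = card (inversions (tower_prod as)) + c"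
    unfolding tower_prod_snoc by (intro card_inversions_desc_word tower_prod_permutes)
  with snoc.IH \<open>is_tower as\<close> show ?case by simp
qed

lemma tower_prod_word:
  "is_tower as \<Longrightarrow>
    \<exists>is. length is = sum_list as \<and> set is \<subseteq> {1..length as} \<and> tower_prod as = lr_prod (map gen is)"
proof (induction as rule: rev_induct)
  case Nil
  show ?case
    by (intro exI[of _ "[]"]) (simp only: tower_prod_Nil list.map lr_prod.simps list.size sum_list.Nil list.set, blast)
next
  case (snoc c as)
  then obtain "is" where "is": "length is = sum_list as" "set is \<subseteq> {1..length as}"
    "tower_prod as = lr_prod (map gen is)" by (auto simp: is_tower_snoc)
  let ?js = "rev [length as + 1 - c + 1..<length as + 1 + 1]"
  have "tower_prod (as @ [c]) = lr_prod (map gen (is @ ?js))"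
    by (simp only: tower_prod_snoc "is" desc_word_def map_append lr_prod_append)
  moreover have "length (is @ ?js) = sum_list (as @ [c])"
    using snoc.prems "is" by (simp add: is_tower_snoc del: upt_Suc)
  moreover have "set (is @ ?js) \<subseteq> {1..length (as @ [c])}"
    using "is" by (auto simp del: upt_Suc)
  ultimately show ?case by blast
qed

text \<open>The word spelled out by the tower attains the sum; the inversion count shows that no
  word is shorter.\<close>

lemma cox_length_tower_prod:
  assumes "is_tower as" "length as = m"
  shows "cox_length m (tower_prod as) = sum_list as"
  unfolding cox_length_def
proof (rule Least_equality)
  show "\<exists>is. length is = sum_list as \<and> set is \<subseteq> {1..m} \<and> tower_prod as = lr_prod (map gen is)"
    using tower_prod_word[OF assms(1)] assms(2) by simp
next
  fix n
  assume "\<exists>is. length is = n \<and> set is \<subseteq> {1..m} \<and> tower_prod as = lr_prod (map gen is)"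
  then show "sum_list as \<le> n"
    using card_inversions_word card_inversions_tower_prod[OF assms(1)] by metis
qed

section \<open>Inverses, the last zero of a tower, and the conclusion\<close>

lemma inv_lr_prod_gen: "inv (lr_prod (map gen is)) = lr_prod (map gen (rev is))"
proof (rule inv_unique_comp)
  have gen_gen: "gen i (gen i x) = x" for i x by (simp add: gen_def)
  have "lr_prod (map gen is) (lr_prod (map gen (rev is)) x) = x" for "is" x
    by (induction "is" arbitrary: x) (auto simp: lr_prod_append gen_gen)
  from this[of "is"] this[of "rev is"]
  show "lr_prod (map gen is) \<circ> lr_prod (map gen (rev is)) = id"
    "lr_prod (map gen (rev is)) \<circ> lr_prod (map gen is) = id"
    by (auto simp: fun_eq_iff)
qed

text \<open>Reversing words preserves their length and alphabet, so the two sets under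
  \<open>LEAST\<close> coincide.\<close>

lemma cox_length_inv:
  assumes "bij w"
  shows "cox_length m (inv w) = cox_length m w"
proof -
  have word_inv: "\<exists>is. length is = n \<and> set is \<subseteq> {1..m} \<and> inv v = lr_prod (map gen is)"
    if "\<exists>is. length is = n \<and> set is \<subseteq> {1..m} \<and> v = lr_prod (map gen is)" for n v
    using that inv_lr_prod_gen by (metis length_rev set_rev)
  have "(\<exists>is. length is = n \<and> set is \<subseteq> {1..m} \<and> inv w = lr_prod (map gen is)) \<longleftrightarrow>
        (\<exists>is. length is = n \<and> set is \<subseteq> {1..m} \<and> w = lr_prod (map gen is))" for n
    using word_inv[of n w] word_inv[of n "inv w"] inv_inv_eq[OF assms] by auto
  then show ?thesis by (simp add: cox_length_def)
qed

text \<open>Induction on n. If k is the new last index, the shorter product fixes the new top point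
  and the last factor is the identity; otherwise the old top point is pushed up by one. Indexing by
  a function admits k = 0, which is no list position.\<close>

lemma tower_prod_last_zero:
  assumes "is_tower (map a [1..<n + 1])" "k \<le> n" "a k = 0"
    and "\<And>i. k < i \<Longrightarrow> i \<le> n \<Longrightarrow> a i > 0"
  shows "tower_prod (map a [1..<n + 1]) (k + 1) = n + 1"
  using assms
proof (induction n)
  case 0
  then show ?case by simp
next
  case (Suc n)
  let ?as = "map a [1..<n + 1]"
  have split: "map a [1..<Suc n + 1] = ?as @ [a (Suc n)]" by simp
  have tow: "is_tower ?as" "a (Suc n) \<le> Suc n"
    using Suc.prems(1) unfolding split is_tower_snoc by (auto simp del: upt_Suc)
  have step: "tower_prod (map a [1..<Suc n + 1]) = tower_prod ?as \<odot> desc_word (Suc n) (a (Suc n))"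
    unfolding split tower_prod_snoc by (simp del: upt_Suc)
  show ?case
  proof (cases "k = Suc n")
    case True
    have "tower_prod ?as (n + 2) = n + 2"
      using tower_prod_permutes[OF tow(1)] by (simp add: permutes_def)
    then show ?thesis using True Suc.prems(3) unfolding step by simp
  next
    case False
    then have "k \<le> n" using Suc.prems(2) by simp
    then have "tower_prod ?as (k + 1) = n + 1"
      using Suc.IH[OF tow(1) _ Suc.prems(3)] Suc.prems(4) le_SucI by blast
    moreover have "a (Suc n) > 0" using Suc.prems False by auto
    \<comment> \<open>A positive last entry puts \<open>Suc n\<close> into the range that the cycle
      shifts up.\<close>
    ultimately show ?thesis
      using tow unfolding step by (simp add: desc_word_apply)
  qed
qed

text \<open>The maximum includes the index m: if \<open>a m = 0\<close>, then w and its inverse fix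
  m + 1, so the new last entry must be 0, that is, k = m. Restricting to i < m would give a positive
  entry there.\<close>

theorem proposition2p4:
  fixes m k :: nat and w w' :: "nat \<Rightarrow> nat" and a :: "nat \<Rightarrow> nat"
  assumes "m \<ge> 1"
    and "w \<in> W m"
    and "tower m w = map a [1..<m + 1]"
    and "a 0 = 0"
    and "k = Max {i. i \<le> m \<and> a i = 0}"
    and "w' = desc_word m (m - k) \<odot> w"
  shows "w' \<in> W (m - 1) \<and>
    int (cox_length m w') = int (cox_length m w) - (int m - int k) \<and>
    tower m (inv w) = tower (m - 1) (inv w') @ [m - k]"
proof -
  have fin: "finite {i. i \<le> m \<and> a i = 0}" by simp
  have "k \<in> {i. i \<le> m \<and> a i = 0}"
    unfolding assms(5) using assms(4) by (intro Max_in) auto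
  then have k: "k \<le> m" "a k = 0" by auto
  have pos: "a i > 0" if "k < i" "i \<le> m" for i
  proof (rule ccontr)
    assume "\<not> a i > 0"
    then have "i \<le> k"
      unfolding assms(5) using that(2) by (intro Max_ge[OF fin]) simp
    with that(1) show False by simp
  qed
  define D where "D = desc_word m (m - k)"
  have D: "D permutes {1..m + 1}" unfolding D_def by (rule desc_word_permutes) auto
  have w: "w permutes {1..m + 1}" using assms(2) by (simp add: W_def)
  have w': "w' = w \<circ> D" using assms(6) by (simp add: D_def)
  have "w (k + 1) = m + 1"
    using tower_prod_last_zero[of a m k] tower_props[OF assms(2)] assms(3) k pos by simp
  \<comment> \<open>D acts first and sends m + 1 to m + 1 - (m - k) = k + 1.\<close>
  then have "w' (m + 1) = m + 1"
    using k by (simp add: w' D_def desc_word_apply)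
  moreover have w'_perm: "w' permutes {1..m + 1}"
    unfolding w' using D w by (rule permutes_compose)
  ultimately have "w' permutes {1..m - 1 + 1}"
    using permutes_fixing_last[of w' m] assms(1) by simp
  then have w'_W: "w' \<in> W (m - 1)" and inv_W: "inv w' \<in> W (m - 1)"
    by (auto simp: W_def intro: permutes_inv)
  define bs where "bs = tower (m - 1) (inv w')"
  have bs: "length bs + 1 = m" "is_tower bs" "tower_prod bs = inv w'"
    using tower_props[OF inv_W] assms(1) by (auto simp: bs_def)
  have "inv w' = inv D \<circ> inv w"
    unfolding w' using permutes_bij[OF w] permutes_bij[OF D] by (rule o_inv_distrib)
  then have "inv w = D \<circ> inv w'"
    by (simp add: comp_assoc[symmetric] permutes_inv_o(1)[OF D])
  then have inv_w: "inv w = tower_prod (bs @ [m - k])"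
    using bs by (simp add: tower_prod_snoc D_def)
  \<comment> \<open>Padding with a zero views \<open>inv w'\<close> inside \<open>W m\<close>, so
    that both lengths refer to the same generators.\<close>
  have inv_w': "inv w' = tower_prod (bs @ [0])"
    using bs by (simp add: tower_prod_snoc)
  have tow: "is_tower (bs @ [m - k])" "is_tower (bs @ [0])"
    using bs by (auto simp: is_tower_snoc)
  \<comment> \<open>Lengths are read off the inverses, whose towers are the ones known
    explicitly.\<close>
  have "cox_length m w = sum_list bs + (m - k)"
    using cox_length_inv[OF permutes_bij[OF w], of m] cox_length_tower_prod[OF tow(1)] bs
    by (simp add: inv_w)
  moreover have "cox_length m w' = sum_list bs"
    using cox_length_inv[OF permutes_bij[OF w'_perm], of m] cox_length_tower_prod[OF tow(2)] bs
    by (simp add: inv_w')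
  moreover have "tower m (inv w) = bs @ [m - k]"
    unfolding inv_w using tow(1) bs by (intro tower_tower_prod) auto
  ultimately show ?thesis
    using w'_W k by (simp add: bs_def)
qed

end
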